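(* Let $\varphi^{\mathcal{T}}(\overline{x},\overline{y})$ be a realizable $\mathrm{LTL}^{\mathcal{T}}$ specification with literals $l_1,\dots,l_n$, and let $\varphi^{\mathbb{B}}(\overline{e},\overline{s})$ be its Boolean abstraction. Let $\alpha$ be a partitioner and $\beta$ a provider for $\varphi^{\mathcal{T}}$. Let $\rho^{\mathbb{B}}=\langle Q,q_0,\delta,o\rangle$ be a winning strategy for the system in $\varphi^{\mathbb{B}}$, and let $\rho^{\mathcal{T}}=C(\alpha,\rho^{\mathbb{B}},\beta)$ be the combined strategy. Then $\rho^{\mathcal{T}}$ is a winning strategy for the system in $\varphi^{\mathcal{T}}$.
   Context: Let $\mathcal{T}$ be a first-order theory with domain $\mathbb{D}$ (interpreted in a fixed structure, so a formula with all free variables replaced by elements of $\mathbb{D}$ is either true or false). An $\mathrm{LTL}^{\mathcal{T}}$ formula is an LTL formula (built with $\top$, $\neg$, $\vee$, next $\bigcirc$, until $\mathcal{U}$ and derived operators such as $\square$) whose atoms are $\mathcal{T}$-literals $l_1,\dots,l_n$. Its variables are split into disjoint sets $\overline{x}$ (controlled by the environment) and $\overline{y}$ (controlled by the system). $\mathrm{val}(\overline{x})$ denotes the set of maps $\overline{x}\to\mathbb{D}$ (similarly for $\overline{y}$). A trace is an infinite sequence of valuations of $\overline{x}\cup\overline{y}$; $\sigma\models l$ iff the valuation $\sigma(0)$ makes $l$ true in $\mathcal{T}$, and the temporal/Boolean operators have the standard LTL semantics. A system strategy for $\varphi^{\mathcal{T}}$ is a tuple $\langle Q,q_0,\delta,o\rangle$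 with $Q$ finite, $q_0\in Q$, $\delta:Q\times\mathrm{val}(\overline{x})\to Q$, $o:Q\times\mathrm{val}(\overline{x})\to\mathrm{val}(\overline{y})$. A play $(x_0,y_0),(x_1,y_1),\dots$ is played according to it if, with $q_0$ the initial state, $q_{i+1}=\delta(q_i,x_i)$ and $y_i=o(q_i,x_i)$ for all $i\ge 0$; the strategy is winning if every play played according to it satisfies $\varphi^{\mathcal{T}}$; $\varphi^{\mathcal{T}}$ is realizable if a winning strategy exists. The same notions apply to propositional LTL with Boolean environment propositions $\overline{e}$ and system propositions $\overline{s}$ (valuations into $\{\mathit{true},\mathit{false}\}$). Boolean abstraction: introduce fresh system propositions $\overline{s}=\{s_1,\dots,s_n\}$, $s_i$ standing for $l_i$. A choice is a set $c\subseteq\overline{s}$ (identified with the valuation of $\overline{s}$ making exactly the elements of $c$ true); its characteristic formula is $f_c(\overline{x},\overline{y})=\bigwedge_{s_i\in c} l_i\wedge\bigwedge_{s_i\notin c}\neg l_i$. A reaction is a set $r$ of choices, with characteristic formula $f_r(\overline{x})=\bigwedge_{c\in r}\exists\overline{y}.f_c\wedge\bigwedge_{c\notin r}\forall\overline{y}.\neg f_c$; $r$ is valid if $\exists\overline{x}.f_r(\overline{x})$ holds. For each valid reaction $r$ there is a fresh environment proposition $e_r$, and $\overline{e}=\{e_r\}$. The Boolean abstraction is $\varphi^{\mathbb{B}}=\varphi^{\mathcal{T}}[l_i\leftarrow s_i]\wedge\square(\varphi^{legal}\to\varphi^{extra})$, where $\varphi^{legal}$ states that exactly one proposition of $\overline{e}$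 is true and $\varphi^{extra}=\bigwedge_{r}\big(e_r\to\bigvee_{c\in r}(\bigwedge_{s_i\in c}s_i\wedge\bigwedge_{s_i\notin c}\neg s_i)\big)$. A partitioner is a function $\alpha:\mathrm{val}(\overline{x})\to\overline{e}$ such that whenever $r$ is a valid reaction and $f_r[\overline{x}\leftarrow v_x]$ is true, $\alpha(v_x)=e_r$; $\alpha(v_x)$ is identified with the valuation of $\overline{e}$ making only $\alpha(v_x)$ true. A provider is a function $\beta:\mathrm{val}(\overline{x})\times\mathrm{val}(\overline{s})\to\mathrm{val}(\overline{y})$ such that for every $v_x\in\mathrm{val}(\overline{x})$, every valid reaction $r$ with $f_r(v_x)$ true, and every choice $c\in r$, the formula $f_c(\overline{x}\leftarrow v_x,\overline{y}\leftarrow\beta(v_x,c))$ is true. The combined strategy $C(\alpha,\rho^{\mathbb{B}},\beta)=\langle Q,q_0,\delta',o'\rangle$ is given by $\delta'(q,v_x)=\delta(q,\alpha(v_x))$ and $o'(q,v_x)=\beta(v_x,o(q,\alpha(v_x)))$. *)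

theory Defs
  imports "HOL-Library.FuncSet"
begin

text \<open>The domain is the type \<open>'d\<close>.  Arities are not tracked: a symbol is interpreted on
  argument lists of every length.\<close>

datatype (tm_funs: 'f, tm_vars: 'v) tm = Var 'v | Fn 'f "('f, 'v) tm list"

datatype ('f, 'p, 'v) fm =
    Rel 'p "('f, 'v) tm list"
  | Eq "('f, 'v) tm" "('f, 'v) tm"
  | FTop
  | FNot "('f, 'p, 'v) fm"
  | FAnd "('f, 'p, 'v) fm" "('f, 'p, 'v) fm"
  | FEx 'v "('f, 'p, 'v) fm"

record ('f, 'p, 'd) interp =
  fun_interp :: "'f \<Rightarrow> 'd list \<Rightarrow> 'd"
  rel_interp :: "'p \<Rightarrow> 'd list \<Rightarrow> bool"

primrec tm_eval :: "('f, 'p, 'd) interp \<Rightarrow> ('v \<Rightarrow> 'd) \<Rightarrow> ('f, 'v) tm \<Rightarrow> 'd" where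
  "tm_eval M \<nu> (Var v) = \<nu> v"
| "tm_eval M \<nu> (Fn f ts) = fun_interp M f (map (tm_eval M \<nu>) ts)"

primrec sat :: "('f, 'p, 'd) interp \<Rightarrow> ('v \<Rightarrow> 'd) \<Rightarrow> ('f, 'p, 'v) fm \<Rightarrow> bool" where
  "sat M \<nu> (Rel p ts) \<longleftrightarrow> rel_interp M p (map (tm_eval M \<nu>) ts)"
| "sat M \<nu> (Eq s t) \<longleftrightarrow> tm_eval M \<nu> s = tm_eval M \<nu> t"
| "sat M \<nu> FTop \<longleftrightarrow> True"
| "sat M \<nu> (FNot A) \<longleftrightarrow> \<not> sat M \<nu> A"
| "sat M \<nu> (FAnd A B) \<longleftrightarrow> sat M \<nu> A \<and> sat M \<nu> B"
| "sat M \<nu> (FEx v A) \<longleftrightarrow> (\<exists>d. sat M (\<nu>(v := d)) A)"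

primrec free_vars :: "('f, 'p, 'v) fm \<Rightarrow> 'v set" where
  "free_vars (Rel p ts) = (\<Union>t\<in>set ts. tm_vars t)"
| "free_vars (Eq s t) = tm_vars s \<union> tm_vars t"
| "free_vars FTop = {}"
| "free_vars (FNot A) = free_vars A"
| "free_vars (FAnd A B) = free_vars A \<union> free_vars B"
| "free_vars (FEx v A) = free_vars A - {v}"

fun is_atom :: "('f, 'p, 'v) fm \<Rightarrow> bool" where
  "is_atom (Rel p ts) = True"
| "is_atom (Eq s t) = True"
| "is_atom _ = False"

definition is_literal :: "('f, 'p, 'v) fm \<Rightarrow> bool" where
  "is_literal l \<longleftrightarrow> is_atom l \<or> (\<exists>A. is_atom A \<and> l = FNot A)"

definition FConj :: "('f, 'p, 'v) fm list \<Rightarrow> ('f, 'p, 'v) fm" where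
  "FConj As = foldr FAnd As FTop"

definition FExs :: "'v list \<Rightarrow> ('f, 'p, 'v) fm \<Rightarrow> ('f, 'p, 'v) fm" where
  "FExs vs A = foldr FEx vs A"

definition FAlls :: "'v list \<Rightarrow> ('f, 'p, 'v) fm \<Rightarrow> ('f, 'p, 'v) fm" where
  "FAlls vs A = foldr (\<lambda>v B. FNot (FEx v (FNot B))) vs A"

text \<open>\<open>holds\<close> is meant for closed formulas, whose truth does not depend on the assignment.\<close>

definition holds :: "('f, 'p, 'd) interp \<Rightarrow> ('f, 'p, 'v) fm \<Rightarrow> bool" where
  "holds M A \<longleftrightarrow> (\<forall>\<nu>. sat M \<nu> A)"

datatype (atoms: 'a) ltl =
    LTop
  | Atom 'a
  | LNot "'a ltl"
  | LOr "'a ltl" "'a ltl"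
  | Next "'a ltl"
  | Until "'a ltl" "'a ltl"
  for map: subst_atoms

definition LAnd :: "'a ltl \<Rightarrow> 'a ltl \<Rightarrow> 'a ltl" where
  "LAnd \<phi> \<psi> = LNot (LOr (LNot \<phi>) (LNot \<psi>))"

definition LImp :: "'a ltl \<Rightarrow> 'a ltl \<Rightarrow> 'a ltl" where
  "LImp \<phi> \<psi> = LOr (LNot \<phi>) \<psi>"

definition Always :: "'a ltl \<Rightarrow> 'a ltl" where
  "Always \<phi> = LNot (Until LTop (LNot \<phi>))"

definition LConj :: "'a ltl list \<Rightarrow> 'a ltl" where
  "LConj \<phi>s = foldr LAnd \<phi>s LTop"

definition LDisj :: "'a ltl list \<Rightarrow> 'a ltl" where
  "LDisj \<phi>s = foldr LOr \<phi>s (LNot LTop)"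

text \<open>\<open>S w a\<close> says that atom \<open>a\<close> is true in the valuation \<open>w\<close>.\<close>

primrec ltl_sat :: "('w \<Rightarrow> 'a \<Rightarrow> bool) \<Rightarrow> (nat \<Rightarrow> 'w) \<Rightarrow> 'a ltl \<Rightarrow> bool" where
  "ltl_sat S \<sigma> LTop \<longleftrightarrow> True"
| "ltl_sat S \<sigma> (Atom a) \<longleftrightarrow> S (\<sigma> 0) a"
| "ltl_sat S \<sigma> (LNot \<phi>) \<longleftrightarrow> \<not> ltl_sat S \<sigma> \<phi>"
| "ltl_sat S \<sigma> (LOr \<phi> \<psi>) \<longleftrightarrow> ltl_sat S \<sigma> \<phi> \<or> ltl_sat S \<sigma> \<psi>"
| "ltl_sat S \<sigma> (Next \<phi>) \<longleftrightarrow> ltl_sat S (\<lambda>i. \<sigma> (i + 1)) \<phi>"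
| "ltl_sat S \<sigma> (Until \<phi> \<psi>) \<longleftrightarrow>
     (\<exists>k. ltl_sat S (\<lambda>i. \<sigma> (i + k)) \<psi> \<and> (\<forall>j<k. ltl_sat S (\<lambda>i. \<sigma> (i + j)) \<phi>))"

text \<open>A valuation of a set of variables is extensional, i.e. \<open>undefined\<close> outside the set, so
  that \<open>val V\<close> really consists of the maps from \<open>V\<close> to \<open>'d\<close>.  Propositional games are the case
  \<open>'d = bool\<close>.\<close>

definition val :: "'v set \<Rightarrow> ('v \<Rightarrow> 'd) set" where
  "val V = V \<rightarrow>\<^sub>E UNIV"

definition join :: "'v set \<Rightarrow> ('v \<Rightarrow> 'd) \<Rightarrow> ('v \<Rightarrow> 'd) \<Rightarrow> 'v \<Rightarrow> 'd" where
  "join X vx vy = (\<lambda>v. if v \<in> X then vx v else vy v)"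

record ('q, 'v, 'd) strategy =
  states :: "'q set"
  init :: 'q
  next_state :: "'q \<Rightarrow> ('v \<Rightarrow> 'd) \<Rightarrow> 'q"
  outp :: "'q \<Rightarrow> ('v \<Rightarrow> 'd) \<Rightarrow> 'v \<Rightarrow> 'd"

definition is_strategy :: "'v set \<Rightarrow> 'v set \<Rightarrow> ('q, 'v, 'd) strategy \<Rightarrow> bool" where
  "is_strategy X Y \<rho> \<longleftrightarrow>
     finite (states \<rho>) \<and> init \<rho> \<in> states \<rho> \<and>
     (\<forall>q\<in>states \<rho>. \<forall>vx\<in>val X. next_state \<rho> q vx \<in> states \<rho> \<and> outp \<rho> q vx \<in> val Y)"

definition played_by ::
  "'v set \<Rightarrow> 'v set \<Rightarrow> ('q, 'v, 'd) strategy \<Rightarrow> (nat \<Rightarrow> ('v \<Rightarrow> 'd) \<times> ('v \<Rightarrow> 'd)) \<Rightarrow> bool" where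
  "played_by X Y \<rho> \<pi> \<longleftrightarrow>
     (\<forall>i. \<pi> i \<in> val X \<times> val Y) \<and>
     (\<exists>q. q 0 = init \<rho> \<and>
          (\<forall>i. q (Suc i) = next_state \<rho> (q i) (fst (\<pi> i)) \<and> snd (\<pi> i) = outp \<rho> (q i) (fst (\<pi> i))))"

definition winning ::
  "'v set \<Rightarrow> 'v set \<Rightarrow> (('v \<Rightarrow> 'd) \<Rightarrow> 'a \<Rightarrow> bool) \<Rightarrow> 'a ltl \<Rightarrow> ('q, 'v, 'd) strategy \<Rightarrow> bool" where
  "winning X Y S \<phi> \<rho> \<longleftrightarrow>
     is_strategy X Y \<rho> \<and>
     (\<forall>\<pi>. played_by X Y \<rho> \<pi> \<longrightarrow> ltl_sat S (\<lambda>i. join X (fst (\<pi> i)) (snd (\<pi> i))) \<phi>)"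

text \<open>State spaces are finite, so natural numbers suffice as states.\<close>

definition realizable ::
  "'v set \<Rightarrow> 'v set \<Rightarrow> (('v \<Rightarrow> 'd) \<Rightarrow> 'a \<Rightarrow> bool) \<Rightarrow> 'a ltl \<Rightarrow> bool" where
  "realizable X Y S \<phi> \<longleftrightarrow> (\<exists>\<rho> :: (nat, 'v, 'd) strategy. winning X Y S \<phi> \<rho>)"

definition winning_T ::
  "('f, 'p, 'd) interp \<Rightarrow> 'v list \<Rightarrow> 'v list \<Rightarrow> ('f, 'p, 'v) fm ltl \<Rightarrow>
   ('q, 'v, 'd) strategy \<Rightarrow> bool" where
  "winning_T M xs ys \<phi> \<rho> \<longleftrightarrow> winning (set xs) (set ys) (sat M) \<phi> \<rho>"

definition realizable_T ::
  "('f, 'p, 'd) interp \<Rightarrow> 'v list \<Rightarrow> 'v list \<Rightarrow> ('f, 'p, 'v) fm ltl \<Rightarrow> bool" where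
  "realizable_T M xs ys \<phi> \<longleftrightarrow> realizable (set xs) (set ys) (sat M) \<phi>"

definition winning_B :: "'v set \<Rightarrow> 'v set \<Rightarrow> 'v ltl \<Rightarrow> ('q, 'v, bool) strategy \<Rightarrow> bool" where
  "winning_B E S \<phi> \<rho> \<longleftrightarrow> winning E S (\<lambda>w p. w p) \<phi> \<rho>"

text \<open>\<open>ls\<close> enumerates the literals of \<open>\<phi>\<close>; \<open>xs\<close> and \<open>ys\<close> list the environment and system
  variables.\<close>

definition ltl_spec ::
  "'v list \<Rightarrow> 'v list \<Rightarrow> ('f, 'p, 'v) fm list \<Rightarrow> ('f, 'p, 'v) fm ltl \<Rightarrow> bool" where
  "ltl_spec xs ys ls \<phi> \<longleftrightarrow>
     set xs \<inter> set ys = {} \<and> distinct ls \<and> set ls = atoms \<phi> \<and>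
     (\<forall>l\<in>set ls. is_literal l \<and> free_vars l \<subseteq> set xs \<union> set ys)"

text \<open>With literals \<open>ls ! 0, \<dots>, ls ! (n - 1)\<close>, a choice is given by the set of indices \<open>i < n\<close>
  of its elements \<open>SProp i\<close>, and a reaction is a set of such index sets.  Choices and reactions
  are finite in number and are enumerated by lists.\<close>

datatype bprop = SProp nat | EProp "nat set set"

definition choices :: "nat \<Rightarrow> nat set list" where
  "choices n = map set (subseqs [0..<n])"

definition reactions :: "nat \<Rightarrow> nat set set list" where
  "reactions n = map set (subseqs (choices n))"

definition choice_fm :: "('f, 'p, 'v) fm list \<Rightarrow> nat set \<Rightarrow> ('f, 'p, 'v) fm" where
  "choice_fm ls c = FConj (map (\<lambda>i. if i \<in> c then ls ! i else FNot (ls ! i)) [0..<length ls])"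

definition reaction_fm ::
  "'v list \<Rightarrow> ('f, 'p, 'v) fm list \<Rightarrow> nat set set \<Rightarrow> ('f, 'p, 'v) fm" where
  "reaction_fm ys ls r =
     FConj (map (\<lambda>c. if c \<in> r then FExs ys (choice_fm ls c) else FAlls ys (FNot (choice_fm ls c)))
                (choices (length ls)))"

definition valid_reactions ::
  "('f, 'p, 'd) interp \<Rightarrow> 'v list \<Rightarrow> 'v list \<Rightarrow> ('f, 'p, 'v) fm list \<Rightarrow> nat set set list" where
  "valid_reactions M xs ys ls =
     filter (\<lambda>r. holds M (FExs xs (reaction_fm ys ls r))) (reactions (length ls))"

definition env_props ::
  "('f, 'p, 'd) interp \<Rightarrow> 'v list \<Rightarrow> 'v list \<Rightarrow> ('f, 'p, 'v) fm list \<Rightarrow> bprop set" where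
  "env_props M xs ys ls = EProp ` set (valid_reactions M xs ys ls)"

definition sys_props :: "('f, 'p, 'v) fm list \<Rightarrow> bprop set" where
  "sys_props ls = SProp ` {..<length ls}"

definition lit_prop :: "('f, 'p, 'v) fm list \<Rightarrow> ('f, 'p, 'v) fm \<Rightarrow> bprop" where
  "lit_prop ls l = SProp (THE i. i < length ls \<and> ls ! i = l)"

definition legal_ltl :: "nat set set list \<Rightarrow> bprop ltl" where
  "legal_ltl rs =
     LDisj (map (\<lambda>r. LAnd (Atom (EProp r))
                     (LConj (map (\<lambda>r'. LNot (Atom (EProp r'))) (filter (\<lambda>r'. r' \<noteq> r) rs)))) rs)"

definition choice_ltl :: "nat \<Rightarrow> nat set \<Rightarrow> bprop ltl" where
  "choice_ltl n c =
     LConj (map (\<lambda>i. if i \<in> c then Atom (SProp i) else LNot (Atom (SProp i))) [0..<n])"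

definition extra_ltl :: "nat \<Rightarrow> nat set set list \<Rightarrow> bprop ltl" where
  "extra_ltl n rs =
     LConj (map (\<lambda>r. LImp (Atom (EProp r))
                     (LDisj (map (choice_ltl n) (filter (\<lambda>c. c \<in> r) (choices n))))) rs)"

definition boolean_abstraction ::
  "('f, 'p, 'd) interp \<Rightarrow> 'v list \<Rightarrow> 'v list \<Rightarrow> ('f, 'p, 'v) fm list \<Rightarrow>
   ('f, 'p, 'v) fm ltl \<Rightarrow> bprop ltl" where
  "boolean_abstraction M xs ys ls \<phi> =
     (let rs = valid_reactions M xs ys ls in
      LAnd (subst_atoms (lit_prop ls) \<phi>)
           (Always (LImp (legal_ltl rs) (extra_ltl (length ls) rs))))"

text \<open>Only the variables \<open>xs\<close> are free in a reaction formula over \<open>ys\<close>, and only \<open>xs\<close> and \<open>ys\<close>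
  in a choice formula, so instantiating them with valuations is evaluation under the valuations.\<close>

definition partitioner ::
  "('f, 'p, 'd) interp \<Rightarrow> 'v list \<Rightarrow> 'v list \<Rightarrow> ('f, 'p, 'v) fm list \<Rightarrow>
   (('v \<Rightarrow> 'd) \<Rightarrow> bprop) \<Rightarrow> bool" where
  "partitioner M xs ys ls \<alpha> \<longleftrightarrow>
     \<alpha> \<in> val (set xs) \<rightarrow> env_props M xs ys ls \<and>
     (\<forall>vx\<in>val (set xs). \<forall>r\<in>set (valid_reactions M xs ys ls).
        sat M vx (reaction_fm ys ls r) \<longrightarrow> \<alpha> vx = EProp r)"

definition choice_val :: "('f, 'p, 'v) fm list \<Rightarrow> nat set \<Rightarrow> bprop \<Rightarrow> bool" where
  "choice_val ls c = (\<lambda>p\<in>sys_props ls. p \<in> SProp ` c)"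

definition only_val :: "bprop set \<Rightarrow> bprop \<Rightarrow> bprop \<Rightarrow> bool" where
  "only_val E e = (\<lambda>p\<in>E. p = e)"

definition provider ::
  "('f, 'p, 'd) interp \<Rightarrow> 'v list \<Rightarrow> 'v list \<Rightarrow> ('f, 'p, 'v) fm list \<Rightarrow>
   (('v \<Rightarrow> 'd) \<Rightarrow> (bprop \<Rightarrow> bool) \<Rightarrow> 'v \<Rightarrow> 'd) \<Rightarrow> bool" where
  "provider M xs ys ls \<beta> \<longleftrightarrow>
     \<beta> \<in> val (set xs) \<rightarrow> val (sys_props ls) \<rightarrow> val (set ys) \<and>
     (\<forall>vx\<in>val (set xs). \<forall>r\<in>set (valid_reactions M xs ys ls).
        sat M vx (reaction_fm ys ls r) \<longrightarrow>
        (\<forall>c\<in>r. sat M (join (set xs) vx (\<beta> vx (choice_val ls c))) (choice_fm ls c)))"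

definition combine ::
  "bprop set \<Rightarrow> (('v \<Rightarrow> 'd) \<Rightarrow> bprop) \<Rightarrow> ('q, bprop, bool) strategy \<Rightarrow>
   (('v \<Rightarrow> 'd) \<Rightarrow> (bprop \<Rightarrow> bool) \<Rightarrow> 'v \<Rightarrow> 'd) \<Rightarrow> ('q, 'v, 'd) strategy" where
  "combine E \<alpha> \<rho> \<beta> =
     \<lparr>states = states \<rho>,
      init = init \<rho>,
      next_state = (\<lambda>q vx. next_state \<rho> q (only_val E (\<alpha> vx))),
      outp = (\<lambda>q vx. \<beta> vx (outp \<rho> q (only_val E (\<alpha> vx))))\<rparr>"

end

theory Submission
  imports Defs
begin

text \<open>A play of the combined strategy is abstracted, position by position, to a play of the
  Boolean strategy.  For every environment valuation exactly one reaction is true, namely the set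
  of all choices that some system valuation realizes; it is valid, so the partitioner returns its
  proposition and the abstract play satisfies \<open>legal_ltl\<close> at all times.  The conjunct
  \<open>extra_ltl\<close> then forces the Boolean output to be one of the choices of this reaction, the
  provider realizes that choice, and hence literals and abstract propositions have the same truth
  values along the two plays.\<close>

section \<open>First-order semantics: coincidence and blocks of quantifiers\<close>

lemma tm_eval_cong:
  "(\<And>v. v \<in> tm_vars t \<Longrightarrow> \<nu> v = \<nu>' v) \<Longrightarrow> tm_eval M \<nu> t = tm_eval M \<nu>' t"
proof (induction t)
  case (Fn f ts)
  then have "map (tm_eval M \<nu>) ts = map (tm_eval M \<nu>') ts"
    by auto
  then show ?case by (simp only: tm_eval.simps)
qed simp

lemma sat_cong:
  "(\<And>v. v \<in> free_vars A \<Longrightarrow> \<nu> v = \<nu>' v) \<Longrightarrow> sat M \<nu> A \<longleftrightarrow> sat M \<nu>' A"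
proof (induction A arbitrary: \<nu> \<nu>')
  case (Rel p ts)
  then have "map (tm_eval M \<nu>) ts = map (tm_eval M \<nu>') ts"
    by (auto intro!: tm_eval_cong)
  then show ?case by (simp only: sat.simps)
next
  case (Eq s t)
  then have "tm_eval M \<nu> s = tm_eval M \<nu>' s" "tm_eval M \<nu> t = tm_eval M \<nu>' t"
    by (auto intro!: tm_eval_cong)
  then show ?case by simp
next
  case (FNot A)
  from FNot.IH[of \<nu> \<nu>'] FNot.prems show ?case by simp
next
  case (FAnd A B)
  from FAnd.IH[of \<nu> \<nu>'] FAnd.prems show ?case by simp
next
  case (FEx v A)
  have "sat M (\<nu>(v := d)) A \<longleftrightarrow> sat M (\<nu>'(v := d)) A" for d
    using FEx.prems by (intro FEx.IH) simp
  then show ?case by simp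
qed simp

lemma sat_FConj [simp]: "sat M \<nu> (FConj As) \<longleftrightarrow> (\<forall>A\<in>set As. sat M \<nu> A)"
  unfolding FConj_def by (induction As) auto

lemma free_vars_FConj [simp]: "free_vars (FConj As) = (\<Union>A\<in>set As. free_vars A)"
  unfolding FConj_def by (induction As) auto

text \<open>The values of \<open>\<mu>\<close> serve as witnesses: each quantifier overwrites
  \<open>\<nu>\<close> at its variable with the value of \<open>\<mu>\<close>, until the two
  assignments coincide.\<close>

lemma sat_FExsI:
  assumes "sat M \<mu> A" and "\<And>v. v \<notin> set vs \<Longrightarrow> \<mu> v = \<nu> v"
  shows "sat M \<nu> (FExs vs A)"
  using assms(2)
proof (induction vs arbitrary: \<nu>)
  case Nil
  then have "\<mu> = \<nu>" by auto
  with assms(1) show ?case by (simp add: FExs_def)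
next
  case (Cons w vs)
  have "sat M (\<nu>(w := \<mu> w)) (FExs vs A)"
    using Cons.prems by (intro Cons.IH) auto
  then show ?case by (auto simp: FExs_def)
qed

lemma free_vars_FExs [simp]: "free_vars (FExs vs A) = free_vars A - set vs"
  unfolding FExs_def by (induction vs) auto

lemma free_vars_FAlls [simp]: "free_vars (FAlls vs A) = free_vars A - set vs"
  unfolding FAlls_def by (induction vs) auto

text \<open>Turns the negative conjuncts of a reaction formula into negations of the positive ones,
  so that each choice contributes a single equivalence.\<close>

lemma sat_FAlls_FNot [simp]: "sat M \<nu> (FAlls vs (FNot A)) \<longleftrightarrow> \<not> sat M \<nu> (FExs vs A)"
  unfolding FAlls_def FExs_def by (induction vs arbitrary: \<nu>) auto

section \<open>Temporal semantics: derived operators and substitution of atoms\<close>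

lemma ltl_sat_LAnd [simp]: "ltl_sat S \<sigma> (LAnd \<phi> \<psi>) \<longleftrightarrow> ltl_sat S \<sigma> \<phi> \<and> ltl_sat S \<sigma> \<psi>"
  by (simp add: LAnd_def)

lemma ltl_sat_LImp [simp]: "ltl_sat S \<sigma> (LImp \<phi> \<psi>) \<longleftrightarrow> (ltl_sat S \<sigma> \<phi> \<longrightarrow> ltl_sat S \<sigma> \<psi>)"
  by (simp add: LImp_def)

lemma ltl_sat_Always [simp]: "ltl_sat S \<sigma> (Always \<phi>) \<longleftrightarrow> (\<forall>k. ltl_sat S (\<lambda>i. \<sigma> (i + k)) \<phi>)"
  by (simp add: Always_def)

lemma ltl_sat_LConj [simp]: "ltl_sat S \<sigma> (LConj \<phi>s) \<longleftrightarrow> (\<forall>\<phi>\<in>set \<phi>s. ltl_sat S \<sigma> \<phi>)"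
  unfolding LConj_def by (induction \<phi>s) auto

lemma ltl_sat_LDisj [simp]: "ltl_sat S \<sigma> (LDisj \<phi>s) \<longleftrightarrow> (\<exists>\<phi>\<in>set \<phi>s. ltl_sat S \<sigma> \<phi>)"
  unfolding LDisj_def by (induction \<phi>s) auto

text \<open>Agreement is required at every position because \<open>Next\<close> and
  \<open>Until\<close> pass to suffixes; both traces are shifted by the same amount, which preserves
  it.\<close>

lemma ltl_sat_subst_atoms:
  "(\<And>i a. a \<in> atoms \<phi> \<Longrightarrow> S' (\<sigma>' i) (g a) \<longleftrightarrow> S (\<sigma> i) a) \<Longrightarrow>
     ltl_sat S' \<sigma>' (subst_atoms g \<phi>) \<longleftrightarrow> ltl_sat S \<sigma> \<phi>"
proof (induction \<phi> arbitrary: \<sigma> \<sigma>')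
  case (LNot \<phi>)
  from LNot.IH[of \<sigma>' \<sigma>] LNot.prems show ?case by simp
next
  case (LOr \<phi> \<psi>)
  from LOr.IH[of \<sigma>' \<sigma>] LOr.prems show ?case by simp
next
  case (Next \<phi>)
  from Next.IH[of "\<lambda>i. \<sigma>' (i + 1)" "\<lambda>i. \<sigma> (i + 1)"] Next.prems show ?case by simp
next
  case (Until \<phi> \<psi>)
  have "ltl_sat S' (\<lambda>i. \<sigma>' (i + k)) (subst_atoms g \<phi>) \<longleftrightarrow> ltl_sat S (\<lambda>i. \<sigma> (i + k)) \<phi>"
       "ltl_sat S' (\<lambda>i. \<sigma>' (i + k)) (subst_atoms g \<psi>) \<longleftrightarrow> ltl_sat S (\<lambda>i. \<sigma> (i + k)) \<psi>" for k
    using Until.prems by (auto intro!: Until.IH)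
  then show ?case by simp
qed auto

section \<open>Choices, reactions and their formulas\<close>

lemma set_choices: "set (choices n) = Pow {..<n}"
  by (simp add: choices_def subseqs_powset atLeast0LessThan)

lemma set_reactions: "set (reactions n) = Pow (Pow {..<n})"
  by (simp add: reactions_def subseqs_powset set_choices)

lemma sat_choice_fm:
  "sat M \<nu> (choice_fm ls c) \<longleftrightarrow> (\<forall>i<length ls. sat M \<nu> (ls ! i) \<longleftrightarrow> i \<in> c)"
  by (auto simp: choice_fm_def simp del: if_image_distrib split: if_splits)

lemma sat_reaction_fm:
  "sat M \<nu> (reaction_fm ys ls r) \<longleftrightarrow>
     (\<forall>c\<subseteq>{..<length ls}. sat M \<nu> (FExs ys (choice_fm ls c)) \<longleftrightarrow> c \<in> r)"
  by (auto simp: reaction_fm_def set_choices simp del: if_image_distrib split: if_splits)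

lemma free_vars_choice_fm: "free_vars (choice_fm ls c) = (\<Union>l\<in>set ls. free_vars l)"
  by (force simp: choice_fm_def in_set_conv_nth split: if_splits)

lemma free_vars_reaction_fm:
  "free_vars (reaction_fm ys ls r) \<subseteq> (\<Union>l\<in>set ls. free_vars l) - set ys"
  by (auto simp: reaction_fm_def free_vars_choice_fm split: if_splits)

text \<open>\<open>holds\<close> ranges over all assignments while the witness \<open>\<mu>\<close>
  is a single one. Overriding an arbitrary \<open>\<nu>\<close> by \<open>\<mu>\<close> on
  \<open>vs\<close> keeps \<open>A\<close> true, since \<open>A\<close> sees only
  \<open>vs\<close>.\<close>

lemma holds_FExs:
  assumes "free_vars A \<subseteq> set vs" and "sat M \<mu> A"
  shows "holds M (FExs vs A)"
  unfolding holds_def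
proof
  fix \<nu>
  have "sat M (join (set vs) \<mu> \<nu>) A \<longleftrightarrow> sat M \<mu> A"
    using assms(1) by (intro sat_cong) (auto simp: join_def)
  with assms(2) show "sat M \<nu> (FExs vs A)"
    by (intro sat_FExsI[of M "join (set vs) \<mu> \<nu>"]) (auto simp: join_def)
qed

lemma ex_valid_reaction:
  assumes "ltl_spec xs ys ls \<phi>"
  obtains r where "r \<in> set (valid_reactions M xs ys ls)" and "sat M \<nu> (reaction_fm ys ls r)"
proof
  define r where "r = {c. c \<subseteq> {..<length ls} \<and> sat M \<nu> (FExs ys (choice_fm ls c))}"
  show sat: "sat M \<nu> (reaction_fm ys ls r)"
    by (auto simp: sat_reaction_fm r_def)
  \<comment> \<open>Literals mention only \<open>xs\<close> and \<open>ys\<close>, and the blocks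
    over \<open>ys\<close> bind the latter, so truth at \<open>\<nu>\<close> alone yields
    validity.\<close>
  have "free_vars (reaction_fm ys ls r) \<subseteq> set xs"
    using free_vars_reaction_fm[of ys ls r] assms unfolding ltl_spec_def by blast
  then have "holds M (FExs xs (reaction_fm ys ls r))"
    using sat by (rule holds_FExs)
  then show "r \<in> set (valid_reactions M xs ys ls)"
    by (auto simp: valid_reactions_def set_reactions r_def)
qed

section \<open>The Boolean abstraction and its valuations\<close>

lemma ltl_sat_choice_ltl:
  "ltl_sat (\<lambda>w p. w p) \<sigma> (choice_ltl n c) \<longleftrightarrow> (\<forall>i<n. \<sigma> 0 (SProp i) \<longleftrightarrow> i \<in> c)"
  by (auto simp: choice_ltl_def simp del: if_image_distrib split: if_splits)

lemma ltl_sat_legal_ltl: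
  "ltl_sat (\<lambda>w p. w p) \<sigma> (legal_ltl rs) \<longleftrightarrow>
     (\<exists>r\<in>set rs. \<forall>r'\<in>set rs. \<sigma> 0 (EProp r') \<longleftrightarrow> r' = r)"
  by (auto simp: legal_ltl_def)

lemma ltl_sat_extra_ltl:
  "ltl_sat (\<lambda>w p. w p) \<sigma> (extra_ltl n rs) \<longleftrightarrow>
     (\<forall>r\<in>set rs. \<sigma> 0 (EProp r) \<longrightarrow>
        (\<exists>c\<subseteq>{..<n}. c \<in> r \<and> (\<forall>i<n. \<sigma> 0 (SProp i) \<longleftrightarrow> i \<in> c)))"
  by (auto simp: extra_ltl_def set_choices ltl_sat_choice_ltl)

text \<open>Distinctness makes the index in the definite description unique.\<close>

lemma lit_prop_nth: "distinct ls \<Longrightarrow> i < length ls \<Longrightarrow> lit_prop ls (ls ! i) = SProp i"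
  by (auto simp: lit_prop_def nth_eq_iff_index_eq)

lemma only_val_in_val: "only_val E e \<in> val E"
  by (simp add: only_val_def val_def)

text \<open>The provider speaks about the function \<open>choice_val ls c\<close> itself, so
  agreement on the propositions must become equality; outside \<open>sys_props ls\<close> both sides
  are \<open>undefined\<close>.\<close>

lemma choice_val_eqI:
  assumes "w \<in> val (sys_props ls)" and "\<And>i. i < length ls \<Longrightarrow> w (SProp i) \<longleftrightarrow> i \<in> c"
  shows "w = choice_val ls c"
proof
  show "w p = choice_val ls c p" for p
    using assms by (auto simp: choice_val_def sys_props_def val_def PiE_def extensional_def)
qed

lemma join_env_props_SProp: "join (env_props M xs ys ls) w u (SProp i) = u (SProp i)"
  by (auto simp: join_def env_props_def)

text \<open>\<open>only_val E\<close> lands in \<open>val E\<close> for every value of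
  \<open>\<alpha>\<close>, so closure of the states carries over from \<open>\<rho>\<close>; the
  typing of \<open>\<beta>\<close> handles the outputs.\<close>

lemma is_strategy_combine:
  assumes "is_strategy E (sys_props ls) \<rho>" and "provider M xs ys ls \<beta>"
  shows "is_strategy (set xs) (set ys) (combine E \<alpha> \<rho> \<beta>)"
  using assms by (auto simp: is_strategy_def combine_def provider_def only_val_in_val Pi_iff)

theorem theorem1:
  fixes M :: "('f, 'p, 'd) interp"
    and xs ys :: "'v list"
    and ls :: "('f, 'p, 'v) fm list"
    and \<phi> :: "('f, 'p, 'v) fm ltl"
    and \<alpha> :: "('v \<Rightarrow> 'd) \<Rightarrow> bprop"
    and \<beta> :: "('v \<Rightarrow> 'd) \<Rightarrow> (bprop \<Rightarrow> bool) \<Rightarrow> 'v \<Rightarrow> 'd"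
    and \<rho> :: "('q, bprop, bool) strategy"
  assumes "ltl_spec xs ys ls \<phi>"
    and "realizable_T M xs ys \<phi>"
    and "partitioner M xs ys ls \<alpha>"
    and "provider M xs ys ls \<beta>"
    and "winning_B (env_props M xs ys ls) (sys_props ls) (boolean_abstraction M xs ys ls \<phi>) \<rho>"
  shows "winning_T M xs ys \<phi> (combine (env_props M xs ys ls) \<alpha> \<rho> \<beta>)"
proof -
  define E where "E = env_props M xs ys ls"
  define rs where "rs = valid_reactions M xs ys ls"
  have strategy: "is_strategy E (sys_props ls) \<rho>"
    using assms(5) by (simp add: winning_B_def winning_def E_def)
  have "ltl_sat (sat M) (\<lambda>i. join (set xs) (fst (\<pi> i)) (snd (\<pi> i))) \<phi>"
    if played: "played_by (set xs) (set ys) (combine E \<alpha> \<rho> \<beta>) \<pi>" for \<pi>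
  proof -
    define w where "w i = only_val E (\<alpha> (fst (\<pi> i)))" for i
    \<comment> \<open>\<open>combine\<close> keeps the states and feeds \<open>\<rho>\<close> the
      inputs \<open>w\<close>, so one state sequence is a run of both strategies.\<close>
    obtain q where q0: "q 0 = init \<rho>"
      and q_Suc: "\<And>i. q (Suc i) = next_state \<rho> (q i) (w i)"
      and snd_\<pi>: "\<And>i. snd (\<pi> i) = \<beta> (fst (\<pi> i)) (outp \<rho> (q i) (w i))"
      using played by (auto simp: played_by_def combine_def w_def)
    define u where "u i = outp \<rho> (q i) (w i)" for i
    have w_val: "w i \<in> val E" for i
      by (simp add: w_def only_val_in_val)
    \<comment> \<open>\<open>is_strategy\<close> constrains outputs only at members of
      \<open>states \<rho>\<close>.\<close>
    have "q i \<in> states \<rho>" for i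
      using strategy w_val by (induction i) (auto simp: q0 q_Suc is_strategy_def)
    then have u_val: "u i \<in> val (sys_props ls)" for i
      using strategy w_val by (auto simp: u_def is_strategy_def)
    define \<sigma> where "\<sigma> i = join E (w i) (u i)" for i
    have "played_by E (sys_props ls) \<rho> (\<lambda>i. (w i, u i))"
      unfolding played_by_def using w_val u_val q0 q_Suc by (auto simp: u_def)
    then have "ltl_sat (\<lambda>w p. w p) \<sigma> (boolean_abstraction M xs ys ls \<phi>)"
      using assms(5) by (auto simp: winning_B_def winning_def E_def \<sigma>_def[abs_def])
    then have subst: "ltl_sat (\<lambda>w p. w p) \<sigma> (subst_atoms (lit_prop ls) \<phi>)"
      and extra: "\<And>i. ltl_sat (\<lambda>w p. w p) (\<lambda>j. \<sigma> (j + i)) (legal_ltl rs) \<Longrightarrow>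
        ltl_sat (\<lambda>w p. w p) (\<lambda>j. \<sigma> (j + i)) (extra_ltl (length ls) rs)"
      by (auto simp: boolean_abstraction_def Let_def rs_def)
    have agree: "\<sigma> i (lit_prop ls l) \<longleftrightarrow> sat M (join (set xs) (fst (\<pi> i)) (snd (\<pi> i))) l"
      if l: "l \<in> set ls" for i l
    proof -
      let ?vx = "fst (\<pi> i)"
      have vx: "?vx \<in> val (set xs)"
        using played by (auto simp: played_by_def mem_Times_iff)
      \<comment> \<open>The reaction is chosen afresh at each position \<open>i\<close>, from the
        environment move there.\<close>
      obtain r where r: "r \<in> set rs" and r_sat: "sat M ?vx (reaction_fm ys ls r)"
        using ex_valid_reaction[OF assms(1)] unfolding rs_def by blast
      have \<alpha>: "\<alpha> ?vx = EProp r"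
        using assms(3) vx r r_sat by (auto simp: partitioner_def rs_def)
      have env: "\<sigma> i (EProp r') \<longleftrightarrow> r' = r" if "r' \<in> set rs" for r'
        using that \<alpha> by (simp add: \<sigma>_def join_def w_def only_val_def E_def env_props_def rs_def)
      have sys: "\<sigma> i (SProp j) \<longleftrightarrow> u i (SProp j)" for j
        by (simp add: \<sigma>_def E_def join_env_props_SProp)
      have "ltl_sat (\<lambda>w p. w p) (\<lambda>j. \<sigma> (j + i)) (legal_ltl rs)"
        using env r by (auto simp: ltl_sat_legal_ltl)
      then have "ltl_sat (\<lambda>w p. w p) (\<lambda>j. \<sigma> (j + i)) (extra_ltl (length ls) rs)"
        by (rule extra)
      \<comment> \<open>By \<open>env\<close>, \<open>EProp r\<close> is true at \<open>i\<close>,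
        so its implication in \<open>extra_ltl\<close> yields a choice in \<open>r\<close>.\<close>
      then obtain c where c: "c \<in> r" and u_c: "\<And>j. j < length ls \<Longrightarrow> u i (SProp j) \<longleftrightarrow> j \<in> c"
        using env r sys by (auto simp: ltl_sat_extra_ltl)
      have "u i = choice_val ls c"
        using u_val u_c by (rule choice_val_eqI)
      then have "sat M (join (set xs) ?vx (snd (\<pi> i))) (choice_fm ls c)"
        using assms(4) vx r r_sat c by (auto simp: provider_def rs_def snd_\<pi> u_def)
      moreover obtain j where "j < length ls" and "l = ls ! j"
        using l by (auto simp: in_set_conv_nth)
      \<comment> \<open>Both sides reduce to \<open>j \<in> c\<close>: the choice formula settles
        the literal, \<open>u_c\<close> the proposition.\<close>
      ultimately show ?thesis
        using assms(1) u_c sys by (simp add: sat_choice_fm lit_prop_nth ltl_spec_def)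
    qed
    have "ltl_sat (\<lambda>w p. w p) \<sigma> (subst_atoms (lit_prop ls) \<phi>) \<longleftrightarrow>
        ltl_sat (sat M) (\<lambda>i. join (set xs) (fst (\<pi> i)) (snd (\<pi> i))) \<phi>"
      using agree assms(1) by (intro ltl_sat_subst_atoms) (simp add: ltl_spec_def)
    with subst show ?thesis by simp
  qed
  then show ?thesis
    using is_strategy_combine[OF strategy assms(4)]
    by (auto simp: winning_T_def winning_def E_def)
qed

end
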